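(* Let $p$ be an odd prime and $n \ge 2p+1$ an integer with $n \equiv 1 \pmod{2p}$, and let $a$ be a positive integer such that $a^p + 1 \equiv 0 \pmod n$ and $\gcd(a^i \pm 1, n) = 1$ for $1 \le i \le p-1$. Then the circulant $\mathrm{Cay}(\mathbb{Z}_n, \langle [a]\rangle)$ is isomorphic to $G_p(A_{p,n,-a})$, where $$A_{p,n,-a} = \left\{\sum_{i=0}^{p-2} a_i\zeta_p^i \in \mathbb{Z}[\zeta_p] : a_i \in \mathbb{Z},\ \sum_{i=0}^{p-2} a_i(-a)^i \equiv 0 \pmod n\right\}.$$
   Context: $\zeta_p = e^{2\pi i/p}$ and $\mathbb{Z}[\zeta_p]$ is the ring of integers of $\mathbb{Q}(\zeta_p)$, with $\mathbb{Z}$-basis $1, \zeta_p, \dots, \zeta_p^{p-2}$. $\langle [a]\rangle$ is the cyclic subgroup of $\mathbb{Z}_n^*$ generated by the residue class of $a$, and $\mathrm{Cay}(\mathbb{Z}_n, S)$ is the Cayley graph on the additive group $\mathbb{Z}_n$ with $x,y$ adjacent iff $x-y\in S$. For a nonzero ideal $A$ of $\mathbb{Z}[\zeta_p]$, $G_p(A)$ is the Cayley graph on the additive group of $\mathbb{Z}[\zeta_p]/A$ with connection set $\{\pm(\zeta_p^i + A) : 0 \le i \le p-1\}$. *)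

theory Defs
  imports
    "HOL-Number_Theory.Residues"
    "HOL-Algebra.Generated_Groups"
    "HOL-Algebra.Generated_Rings"
    "HOL-Algebra.Algebraic_Closure_Type"
    "Graph_Theory.Graph_Theory"
begin

text \<open>
  Graphs are symmetric digraphs, as in \<^theory>\<open>Graph_Theory.Digraph\<close>. The ring \<open>R\<close> only
  contributes its additive group. For an arbitrary \<open>S\<close> this is the Cayley digraph; it is an
  undirected (simple) graph if \<open>S\<close> is closed under negation (and does not contain zero).
\<close>

definition cayley_graph :: "('a, 'b) ring_scheme \<Rightarrow> 'a set \<Rightarrow> 'a pair_pre_digraph" where
  "cayley_graph R S =
     \<lparr> pverts = carrier R,
       parcs = {(x, y). x \<in> carrier R \<and> y \<in> carrier R \<and> x \<ominus>\<^bsub>R\<^esub> y \<in> S} \<rparr>"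

text \<open>
  \<^term>\<open>residue_ring n\<close> has the representatives \<open>0, \<dots>, n - 1\<close> as its carrier, so the class of \<open>a\<close>
  is \<open>a mod n\<close>. The generated subgroup is only meaningful for \<open>a\<close> coprime to \<open>n\<close>.
\<close>

definition residue_cyclic_subgroup :: "int \<Rightarrow> int \<Rightarrow> int set" where
  "residue_cyclic_subgroup n a = generate (units_of (residue_ring n)) {a mod n}"

definition zeta :: "nat \<Rightarrow> complex" where
  "zeta p = exp (2 * of_real pi * \<i> / of_nat p)"

definition cyclotomic_ring :: "nat \<Rightarrow> complex ring" where
  "cyclotomic_ring p =
     ring_of_type_algebra \<lparr> carrier := generate_ring ring_of_type_algebra {zeta p} \<rparr>"

definition graph_G :: "nat \<Rightarrow> complex set \<Rightarrow> complex set pair_pre_digraph" where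
  "graph_G p A =
     (let R = cyclotomic_ring p; Q = R Quot A
      in cayley_graph Q
           ((\<lambda>i. A +>\<^bsub>R\<^esub> zeta p ^ i) ` {0..p - 1} \<union>
            (\<lambda>i. \<ominus>\<^bsub>Q\<^esub> (A +>\<^bsub>R\<^esub> zeta p ^ i)) ` {0..p - 1}))"

definition ideal_A :: "nat \<Rightarrow> int \<Rightarrow> int \<Rightarrow> complex set" where
  "ideal_A p n b =
     {(\<Sum>i = 0..p - 2. of_int (c i) * zeta p ^ i) | c :: nat \<Rightarrow> int.
        [(\<Sum>i = 0..p - 2. c i * b ^ i) = 0] (mod n)}"

subsection \<open>Well-definedness\<close>

lemma cring_cyclotomic_ring: "cring (cyclotomic_ring p)"
proof -
  let ?C = "ring_of_type_algebra :: complex ring"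
  interpret C: cring ?C by (rule cring_from_type_algebra)
  have "subring (generate_ring ?C {zeta p}) ?C"
    by (rule C.generate_ring_is_subring) (simp add: ring_of_type_algebra_def)
  then have "subcring (generate_ring ?C {zeta p}) ?C"
    by (rule C.subcringI')
  then show ?thesis
    unfolding cyclotomic_ring_def
    by (subst C.subcring_iff[symmetric]) (auto simp: ring_of_type_algebra_def)
qed

lemma cyclotomic_ring_simps [simp]:
  "monoid.mult (cyclotomic_ring p) = (*)" "ring.add (cyclotomic_ring p) = (+)"
  "monoid.one (cyclotomic_ring p) = 1" "ring.zero (cyclotomic_ring p) = 0"
  by (simp_all add: cyclotomic_ring_def ring_of_type_algebra_def)

lemma uminus_ring_of_type_algebra [simp]:
  "\<ominus>\<^bsub>(ring_of_type_algebra :: complex ring)\<^esub> x = - x"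
proof -
  interpret C: cring "ring_of_type_algebra :: complex ring" by (rule cring_from_type_algebra)
  show ?thesis
    by (rule C.minus_equality) (simp_all add: ring_of_type_algebra_def)
qed

lemma zeta_in_cyclotomic_ring: "zeta p \<in> carrier (cyclotomic_ring p)"
  by (simp add: cyclotomic_ring_def generate_ring.incl)

lemma zeta_power: "p > 0 \<Longrightarrow> zeta p ^ p = 1"
  by (simp add: zeta_def flip: exp_of_nat_mult)

lemma zeta_neq_1:
  assumes p: "p > 1"
  shows "zeta p \<noteq> 1"
proof
  assume "zeta p = 1"
  then have "cos (2 * pi / real p) = 1"
    by (auto simp: zeta_def exp_eq_polar complex_eq_iff Re_exp)
  then obtain k :: int where "2 * pi / real p = real_of_int k * 2 * pi"
    by (auto simp: cos_one_2pi_int)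
  then have "real_of_int (k * int p) = 1"
    using p by (simp add: field_simps)
  then have "int p dvd 1"
    by (metis dvd_triv_right of_int_eq_1_iff)
  then show False
    using p by simp
qed

lemma sum_shift_reduce:
  fixes x :: "'a :: comm_ring_1"
  shows "(\<Sum>i = 0..m. ((if i = 0 then 0 else c (i - 1)) - c m) * x ^ i) =
         x * (\<Sum>i = 0..m. c i * x ^ i) - c m * (\<Sum>i = 0..Suc m. x ^ i)"
proof -
  have *: "(\<Sum>i = 0..m. (if i = 0 then 0 else c (i - 1)) * x ^ i) =
           x * (\<Sum>i = 0..m. c i * x ^ i) - c m * x ^ Suc m" for m
    by (induction m) (auto simp: algebra_simps)
  show ?thesis
    unfolding left_diff_distrib sum_subtractf *
    by (simp add: sum_distrib_left algebra_simps)
qed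

lemma ideal_ideal_A:
  assumes p: "p \<ge> 2" and b: "[b ^ p = 1] (mod n)" and coprime: "gcd (b - 1) n = 1"
  shows "ideal (ideal_A p n b) (cyclotomic_ring p)"
proof -
  let ?R = "cyclotomic_ring p"
  interpret R: cring ?R by (rule cring_cyclotomic_ring)
  define m where "m = p - 2"
  have p_eq: "p = Suc (Suc m)" using p by (simp add: m_def)
  have sum_zeta: "(\<Sum>i = 0..Suc m. zeta p ^ i) = 0"
    using geometric_sum[of "zeta p" p] zeta_power[of p] zeta_neq_1[of p] p
    by (simp add: p_eq lessThan_Suc_atMost atMost_atLeast0)
  have sum_b: "n dvd (\<Sum>i = 0..Suc m. b ^ i)"
  proof -
    have "(b - 1) * (\<Sum>i = 0..Suc m. b ^ i) = b ^ p - 1"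
      using power_diff_1_eq[of b p] by (simp add: p_eq lessThan_Suc_atMost atMost_atLeast0)
    then have "n dvd (b - 1) * (\<Sum>i = 0..Suc m. b ^ i)"
      using b by (simp add: cong_iff_dvd_diff)
    then show ?thesis
      using coprime by (metis coprime_dvd_mult_right_iff coprime_iff_gcd_eq_1 gcd.commute)
  qed
  have zetaI: "zeta p ^ i \<in> carrier ?R" for i
    using zeta_in_cyclotomic_ring[of p] R.m_closed R.one_closed by (induction i) auto
  have negI: "- x \<in> carrier ?R" if "x \<in> carrier ?R" for x
    using that generate_ring.a_inv[of x "ring_of_type_algebra :: complex ring" "{zeta p}"]
    by (simp add: cyclotomic_ring_def)
  have natI: "of_nat k \<in> carrier ?R" for k
    using R.zero_closed R.one_closed R.a_closed by (induction k) auto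
  have intI: "of_int k \<in> carrier ?R" for k
    using natI negI by (cases k rule: int_cases2) auto
  have sumI: "sum f I \<in> carrier ?R" if "\<And>i. f i \<in> carrier ?R" for f and I :: "nat set"
    using that R.zero_closed R.a_closed by (induction I rule: infinite_finite_induct) auto
  have A_closed: "ideal_A p n b \<subseteq> carrier ?R"
    unfolding ideal_A_def using R.m_closed intI zetaI by (auto intro!: sumI)
  have A_add: "x + y \<in> ideal_A p n b" if xy: "x \<in> ideal_A p n b" "y \<in> ideal_A p n b" for x y
  proof -
    obtain c d where
      "x = (\<Sum>i = 0..p - 2. of_int (c i) * zeta p ^ i)" "n dvd (\<Sum>i = 0..p - 2. c i * b ^ i)"
      "y = (\<Sum>i = 0..p - 2. of_int (d i) * zeta p ^ i)" "n dvd (\<Sum>i = 0..p - 2. d i * b ^ i)"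
      using xy by (auto simp: ideal_A_def cong_0_iff)
    then show ?thesis
      unfolding ideal_A_def mem_Collect_eq cong_0_iff
      by (intro exI[of _ "\<lambda>i. c i + d i"]) (simp add: ring_distribs sum.distrib)
  qed
  have A_neg: "- x \<in> ideal_A p n b" if x: "x \<in> ideal_A p n b" for x
  proof -
    obtain c where
      "x = (\<Sum>i = 0..p - 2. of_int (c i) * zeta p ^ i)" "n dvd (\<Sum>i = 0..p - 2. c i * b ^ i)"
      using x by (auto simp: ideal_A_def cong_0_iff)
    then show ?thesis
      unfolding ideal_A_def mem_Collect_eq cong_0_iff
      by (intro exI[of _ "\<lambda>i. - c i"]) (simp add: sum_negf)
  qed
  have A_zeta: "zeta p * x \<in> ideal_A p n b" if x: "x \<in> ideal_A p n b" for x
  proof -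
    obtain c where c:
      "x = (\<Sum>i = 0..m. of_int (c i) * zeta p ^ i)" "n dvd (\<Sum>i = 0..m. c i * b ^ i)"
      using x by (auto simp: ideal_A_def cong_0_iff m_def)
    define d where "d i = (if i = 0 then 0 else c (i - 1)) - c m" for i
    have "(\<Sum>i = 0..m. of_int (d i) * zeta p ^ i) = zeta p * x"
      using sum_shift_reduce[of "\<lambda>i. of_int (c i)" m "zeta p"] c(1)
      unfolding sum_zeta by (simp add: d_def if_distrib[of of_int] cong: if_cong)
    moreover have "n dvd (\<Sum>i = 0..m. d i * b ^ i)"
      unfolding d_def sum_shift_reduce using c(2) sum_b by (intro dvd_diff dvd_mult)
    ultimately show ?thesis
      unfolding ideal_A_def mem_Collect_eq cong_0_iff m_def[symmetric] by (intro exI[of _ d]) simp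
  qed
  have A_mult: "h * x \<in> ideal_A p n b" if "h \<in> carrier ?R" "x \<in> ideal_A p n b" for h x
  proof -
    have "h \<in> generate_ring ring_of_type_algebra {zeta p}"
      using that(1) by (simp add: cyclotomic_ring_def)
    then show ?thesis
      using that(2)
    proof (induction h arbitrary: x rule: generate_ring.induct)
      case one
      then show ?case by (simp add: ring_of_type_algebra_def)
    next
      case (incl h)
      then show ?case using A_zeta by simp
    next
      case (a_inv h)
      then show ?case using A_neg by simp
    next
      case (eng_add h1 h2)
      then show ?case using A_add by (simp add: ring_of_type_algebra_def distrib_right)
    next
      case (eng_mult h1 h2)
      then show ?case by (simp add: ring_of_type_algebra_def mult.assoc)
    qed
  qed
  have A_mult': "x * h \<in> ideal_A p n b" if "h \<in> carrier ?R" "x \<in> ideal_A p n b" for h x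
    using A_mult[OF that] by (simp only: mult.commute)
  have A_0: "0 \<in> ideal_A p n b"
    unfolding ideal_A_def mem_Collect_eq by (intro exI[of _ "\<lambda>_. 0"]) simp
  have uminus: "\<ominus>\<^bsub>?R\<^esub> x = - x" if "x \<in> carrier ?R" for x
    by (rule R.minus_equality) (use that negI in simp_all)
  have "subgroup (ideal_A p n b) (add_monoid ?R)"
    using A_closed A_add A_0 A_neg uminus
    by (intro R.add.subgroupI) (auto simp: a_inv_def[symmetric])
  then show ?thesis
    using A_mult A_mult' by (intro idealI R.ring_axioms) auto
qed

lemma ideal_A_nonzero:
  assumes "n \<noteq> 0"
  shows "ideal_A p n b \<noteq> {0}"
proof -
  have "of_int n \<in> ideal_A p n b"
    unfolding ideal_A_def mem_Collect_eq
    by (intro exI[of _ "\<lambda>i. if i = 0 then n else 0"])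
       (simp add: if_distrib if_distribR sum.delta cong_0_iff cong: if_cong)
  then show ?thesis
    using assms by auto
qed

end

theory Submission
  imports Defs
begin

text \<open>
  Put \<open>b = -a\<close>. Since \<open>b ^ p = 1\<close> and \<open>b - 1\<close> is invertible modulo \<open>n\<close>, the polynomial
  \<open>\<Phi> = 1 + x + \<dots> + x ^ (p - 1)\<close> vanishes at \<open>b\<close> modulo \<open>n\<close>. By Eisenstein's criterion \<open>\<Phi>\<close> is
  irreducible, so it divides every integer polynomial that vanishes at \<open>zeta p\<close>, and
  \<open>f (zeta p) \<mapsto> f b mod n\<close> is a well-defined surjective ring homomorphism with kernel
  \<open>ideal_A p n b\<close>. The induced isomorphism onto the residue ring maps the connection set to
  \<open>{\<plusminus> b ^ i | i < p}\<close>, which is the set of powers of \<open>a\<close> because \<open>a ^ p = -1\<close>.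
\<close>


section \<open>Eisenstein's criterion over an integral domain\<close>

text \<open>Take the least \<open>j\<close> such that \<open>q\<close> does not divide coefficient
  \<open>j\<close> of \<open>g\<close>. Modulo \<open>q\<close>, coefficient \<open>j\<close> of
  \<open>g * h\<close> is \<open>coeff g j * coeff h 0\<close>, which is nonzero because
  \<open>q\<close> is prime. So \<open>degree E \<le> j \<le> degree g\<close>, which leaves no
  degree for \<open>h\<close>.\<close>

lemma eisenstein_constant_factor:
  fixes E g h :: "'a::idom poly"
  assumes q: "prime_elem q" and E: "E = g * h" and lc: "\<not> q dvd lead_coeff E"
    and low: "\<And>i. i < degree E \<Longrightarrow> q dvd coeff E i" and h0: "\<not> q dvd coeff h 0"
  shows "degree h = 0"
proof -
  have nz: "g \<noteq> 0" "h \<noteq> 0" using lc E by auto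
  have ex: "\<not> q dvd coeff g (degree g)"
    using lc by (auto simp: E lead_coeff_mult)
  define j where "j = (LEAST i. \<not> q dvd coeff g i)"
  have j: "\<not> q dvd coeff g j" unfolding j_def by (rule LeastI[of _ "degree g"]) (rule ex)
  have jle: "j \<le> degree g" unfolding j_def by (rule Least_le) (rule ex)
  have less: "q dvd coeff g i" if "i < j" for i
    using not_less_Least[of i "\<lambda>i. \<not> q dvd coeff g i"] that by (auto simp: j_def)
  have "coeff E j = (\<Sum>i<j. coeff g i * coeff h (j - i)) + coeff g j * coeff h 0"
    by (simp add: E coeff_mult flip: lessThan_Suc_atMost)
  moreover have "q dvd (\<Sum>i<j. coeff g i * coeff h (j - i))"
    by (intro dvd_sum dvd_mult2 less) auto
  moreover have "\<not> q dvd coeff g j * coeff h 0"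
    using j h0 q by (simp add: prime_elem_dvd_mult_iff)
  ultimately have "\<not> q dvd coeff E j"
    by (simp add: dvd_add_right_iff)
  then have "degree E \<le> j" using low by (meson not_le)
  then show ?thesis using jle nz by (simp add: E degree_mult_eq)
qed

text \<open>Since the square of \<open>q\<close> does not divide the constant coefficient,
  \<open>q\<close> misses the constant coefficient of one factor, and
  \<open>eisenstein_constant_factor\<close> makes that factor constant. Its leading coefficient
  divides 1, so it is a unit.\<close>

lemma eisenstein_criterion:
  fixes E :: "'a::idom poly"
  assumes q: "prime_elem q" and lc: "lead_coeff E = 1" and deg: "degree E > 0"
    and low: "\<And>i. i < degree E \<Longrightarrow> q dvd coeff E i" and c0: "\<not> q\<^sup>2 dvd coeff E 0"
  shows "Factorial_Ring.irreducible E"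
proof (rule Factorial_Ring.irreducibleI)
  show "E \<noteq> 0" "\<not> E dvd 1" using deg lc by (auto simp: is_unit_poly_iff)
  fix g h assume E: "E = g * h"
  have ndvd: "\<not> q dvd lead_coeff E" using q lc by (simp add: prime_elem_not_unit)
  have "\<not> q dvd coeff h 0 \<or> \<not> q dvd coeff g 0"
    using c0 by (auto simp: E coeff_mult power2_eq_square intro: mult_dvd_mono)
  then have "degree h = 0 \<or> degree g = 0"
    using eisenstein_constant_factor[OF q E ndvd low] eisenstein_constant_factor[OF q _ ndvd low, of h g] E
    by (auto simp: mult.commute)
  moreover have "lead_coeff g * lead_coeff h = 1"
    using lc by (simp add: E lead_coeff_mult)
  moreover have "k dvd 1" if "degree k = 0" "lead_coeff k dvd 1" for k :: "'a poly"
    using that by (auto elim!: degree_eq_zeroE simp: is_unit_const_poly_iff)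
  ultimately show "g dvd 1 \<or> h dvd 1"
    by (metis dvd_triv_left dvd_triv_right)
qed

section \<open>Evaluation of integer polynomials in commutative rings\<close>

text \<open>Polymorphic in the target, so that the same identities serve at \<open>zeta p\<close> in
  the complex numbers and at \<open>b\<close> in the integers.\<close>

abbreviation ipoly :: "int poly \<Rightarrow> 'a::comm_ring_1 \<Rightarrow> 'a" where
  "ipoly f x \<equiv> poly (map_poly of_int f) x"

lemma ipoly_add [simp]: "ipoly (f + g) x = ipoly f x + ipoly g x"
proof -
  have "map_poly (of_int :: int \<Rightarrow> 'a) (f + g) = map_poly of_int f + map_poly of_int g"
    by (rule poly_eqI) (simp add: coeff_map_poly)
  then show ?thesis by simp
qed

lemma ipoly_mult [simp]: "ipoly (f * g) x = ipoly f x * ipoly g x"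
proof -
  have "map_poly (of_int :: int \<Rightarrow> 'a) (f * g) = map_poly of_int f * map_poly of_int g"
    by (rule poly_eqI) (simp add: coeff_map_poly coeff_mult)
  then show ?thesis by simp
qed

lemma ipoly_uminus [simp]: "ipoly (- f) x = - ipoly f x"
proof -
  have "map_poly (of_int :: int \<Rightarrow> 'a) (- f) = - map_poly of_int f"
    by (rule poly_eqI) (simp add: coeff_map_poly)
  then show ?thesis by simp
qed

lemma ipoly_monom: "ipoly (monom c i) x = of_int c * x ^ i"
  by (simp add: map_poly_monom poly_monom)

lemma ipoly_sum: "ipoly (sum f A) x = (\<Sum>i\<in>A. ipoly (f i) x)"
  by (induction A rule: infinite_finite_induct) auto

lemma ipoly_altdef:
  assumes "degree f \<le> m"
  shows "ipoly f x = (\<Sum>i\<le>m. of_int (coeff f i) * x ^ i)"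
  by (subst poly_as_sum_of_monoms'[OF assms, symmetric]) (simp add: ipoly_sum ipoly_monom)

section \<open>Integer polynomials with a common root\<close>

text \<open>Gauss's lemma: the content is multiplicative, so the cofactor \<open>q\<close> has the
  content of \<open>smult a f\<close>. Hence \<open>a\<close> divides every coefficient of
  \<open>q\<close> and cancels.\<close>

lemma primitive_dvd_smult:
  fixes g f :: "int poly"
  assumes g: "content g = 1" and a: "a \<noteq> 0" and dvd: "g dvd smult a f"
  shows "g dvd f"
proof -
  obtain q where q: "smult a f = g * q" using dvd by blast
  have "content q = content (smult a f)"
    using q g by (simp add: content_mult)
  then have "a dvd content q" by simp
  then have "[:a:] dvd q" by (simp add: const_poly_dvd_iff_dvd_content)
  then obtain q' where "q = smult a q'" by auto
  then have "smult a (f - g * q') = 0" using q by (simp add: smult_diff_right)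
  then show ?thesis using a by (simp add: smult_eq_0_iff)
qed

text \<open>The integer polynomials vanishing at \<open>x\<close> are the multiples of one primitive
  polynomial \<open>g\<close> of least degree: pseudo-division by \<open>g\<close> leaves remainder
  0 by minimality, and \<open>primitive_dvd_smult\<close> removes the scalar. The irreducible
  \<open>E\<close> is then \<open>g\<close> up to a unit.\<close>

lemma irreducible_dvd_of_common_root:
  fixes E f :: "int poly" and x :: "'a::{idom, ring_char_0}"
  assumes irr: "Factorial_Ring.irreducible E" and Ex: "ipoly E x = 0" and fx: "ipoly f x = 0"
  shows "E dvd f"
proof -
  define P where "P g \<longleftrightarrow> g \<noteq> 0 \<and> ipoly g x = 0" for g
  have "P E" using irr Ex by (auto simp: P_def Factorial_Ring.irreducible_def)
  then obtain g0 where g0: "P g0" and min: "\<And>r. P r \<Longrightarrow> degree g0 \<le> degree r"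
    by (metis arg_min_natI arg_min_nat_le)
  define g where "g = primitive_part g0"
  have g0_eq: "g0 = [:content g0:] * g" by (simp add: g_def)
  \<comment> \<open>In an integral domain of characteristic 0 the nonzero factor
    \<open>content g0\<close> cancels, so \<open>x\<close> is also a root of the primitive
    part.\<close>
  have "ipoly g0 x = of_int (content g0) * ipoly g x"
    by (subst g0_eq, subst ipoly_mult) (simp add: map_poly_pCons)
  with g0 have g: "g \<noteq> 0" "ipoly g x = 0" "content g = 1"
    by (auto simp: P_def g_def)
  have deg: "degree g = degree g0" by (simp add: g_def)
  have *: "g dvd k" if k: "ipoly k x = 0" for k
  proof -
    obtain a q where a: "a \<noteq> 0" "smult a k = g * q + pseudo_mod k g"
      using pseudo_mod(1)[OF g(1)] by blast
    have "ipoly ([:a:] * k) x = 0" by (simp only: ipoly_mult k) simp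
    then have "ipoly (pseudo_mod k g) x = 0" using a(2) g(2) by simp
    moreover have "pseudo_mod k g = 0 \<or> degree (pseudo_mod k g) < degree g"
      by (rule pseudo_mod(2)[OF g(1)])
    ultimately have "pseudo_mod k g = 0" using min deg by (force simp: P_def)
    then have "g dvd smult a k" using a(2) by simp
    then show ?thesis by (rule primitive_dvd_smult[OF g(3) a(1)])
  qed
  obtain h where h: "E = g * h" using *[OF Ex] by blast
  \<comment> \<open>A unit would be a nonzero constant, which has no root. Irreducibility then
    forces the cofactor \<open>h\<close> to be the unit.\<close>
  have "\<not> g dvd 1"
  proof
    assume "g dvd 1"
    then obtain c where "g = [:c:]" by (auto simp: is_unit_poly_iff)
    then show False using g by (auto simp: map_poly_pCons)
  qed
  then have "h dvd 1" using Factorial_Ring.irreducibleD[OF irr h] by blast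
  then have "E dvd g" by (simp add: h mult_unit_dvd_iff)
  then show ?thesis using *[OF fx] by (rule dvd_trans)
qed

section \<open>Irreducibility of the cyclotomic polynomial of prime index\<close>

text \<open>This is (x^p - 1) / (x - 1) for every \<open>p\<close>; it is the p-th cyclotomic
  polynomial exactly when \<open>p\<close> is prime.\<close>

definition prime_cyclotomic :: "nat \<Rightarrow> int poly" where
  "prime_cyclotomic p = (\<Sum>i<p. monom 1 i)"

lemma coeff_prime_cyclotomic: "coeff (prime_cyclotomic p) i = (if i < p then 1 else 0)"
  by (simp add: prime_cyclotomic_def coeff_sum)

lemma degree_prime_cyclotomic: "degree (prime_cyclotomic p) = p - 1"
proof (cases "p = 0")
  case False
  then show ?thesis
    by (intro antisym degree_le le_degree) (auto simp: coeff_prime_cyclotomic)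
qed (simp add: prime_cyclotomic_def)

lemma ipoly_prime_cyclotomic: "ipoly (prime_cyclotomic p) x = (\<Sum>i<p. x ^ i)"
  by (simp add: prime_cyclotomic_def ipoly_sum ipoly_monom)

text \<open>Substituting x + 1 for x gives ((x + 1)^p - 1) / x. Its coefficients are the binomials
  \<open>p choose Suc i\<close>: all but the leading one are divisible by \<open>p\<close>, and the
  constant one is \<open>p\<close> itself, so Eisenstein applies. A factorization of the original
  polynomial survives the substitution.\<close>

lemma irreducible_prime_cyclotomic:
  assumes p: "Factorial_Ring.prime p"
  shows "Factorial_Ring.irreducible (prime_cyclotomic p)"
proof -
  let ?C = "prime_cyclotomic p"
  define E where "E = pcompose ?C [:1, 1:]"
  have p1: "p > 1" using p by (rule prime_gt_1_nat)
  have C: "?C * [:-1, 1:] = monom 1 p - 1"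
  proof (rule poly_eqI)
    fix i show "coeff (?C * [:-1, 1:]) i = coeff (monom 1 p - 1) i"
      using p1 by (cases i) (auto simp: coeff_prime_cyclotomic coeff_pCons mult.commute[of ?C])
  qed
  have shift: "pcompose (?C * [:-1, 1:]) [:1, 1:] = [:1, 1:] ^ p - 1"
  proof -
    have "pcompose (monom 1 k) [:1, 1:] = [:1, 1:] ^ k" for k :: nat
      by (induction k) (simp_all add: monom_Suc pcompose_pCons pcompose_1)
    then show ?thesis unfolding C by (simp add: pcompose_diff pcompose_1)
  qed
  \<comment> \<open>The substitution turns the factor x - 1 into x, and multiplication by x is
    \<open>pCons 0\<close>. This is the index shift in \<open>coeffE\<close>.\<close>
  have pE: "pCons 0 E = [:1, 1:] ^ p - 1"
    using shift unfolding pcompose_mult E_def by (simp add: pcompose_pCons)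
  have coeffE: "coeff E i = int (p choose Suc i)" if "i < p" for i
  proof -
    have "coeff E i = coeff ([:1, 1:] ^ p - 1) (Suc i)"
      by (simp flip: pE)
    then show ?thesis using that by (simp add: coeff_linear_poly_power)
  qed
  have degE: "degree E = p - 1" by (simp add: E_def degree_pcompose degree_prime_cyclotomic)
  have "Factorial_Ring.irreducible E"
  proof (rule eisenstein_criterion[of "int p"])
    show "prime_elem (int p)" using p by simp
    show "lead_coeff E = 1" "degree E > 0" using p1 by (simp_all add: coeffE degE)
    show "int p dvd coeff E i" if "i < degree E" for i
      using that p p1 dvd_choose_prime[of "Suc i" p] by (simp add: coeffE degE)
    show "\<not> (int p)\<^sup>2 dvd coeff E 0"
      using p1 by (simp add: coeffE power2_eq_square)
  qed
  show ?thesis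
  proof (rule Factorial_Ring.irreducibleI)
    show "?C \<noteq> 0" "\<not> ?C dvd 1"
      using p1 degree_prime_cyclotomic[of p] by (auto simp: is_unit_poly_iff)
    \<comment> \<open>Substituting x + 1 preserves degrees, so only constants can become
      units.\<close>
    have unit: "k dvd 1" if k: "pcompose k [:1, 1:] dvd 1" for k :: "int poly"
    proof -
      obtain c where c: "pcompose k [:1, 1:] = [:c:]" "c dvd 1"
        using k by (auto simp: is_unit_poly_iff)
      have "degree k = degree (pcompose k [:1, 1:])" by (simp add: degree_pcompose)
      with c have "degree k = 0" by simp
      then show ?thesis using c by (auto elim!: degree_eq_zeroE simp: is_unit_const_poly_iff)
    qed
    fix g h assume "?C = g * h"
    then have "E = pcompose g [:1, 1:] * pcompose h [:1, 1:]"
      by (simp add: E_def pcompose_mult)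
    then show "g dvd 1 \<or> h dvd 1"
      using Factorial_Ring.irreducibleD[OF \<open>Factorial_Ring.irreducible E\<close>] unit by blast
  qed
qed


section \<open>Evaluation of cyclotomic integers modulo n\<close>

lemma ipoly_prime_cyclotomic_zeta: "p > 1 \<Longrightarrow> ipoly (prime_cyclotomic p) (zeta p) = 0"
  using geometric_sum[of "zeta p" p] zeta_power[of p] zeta_neq_1[of p]
  by (simp add: ipoly_prime_cyclotomic)

text \<open>The divisibility holds over the integers and not just over the rationals, so it can
  afterwards be evaluated at \<open>b\<close> and reduced modulo \<open>n\<close>.\<close>

lemma prime_cyclotomic_dvd_iff:
  assumes "Factorial_Ring.prime p"
  shows "prime_cyclotomic p dvd f \<longleftrightarrow> ipoly f (zeta p) = 0"
proof
  have 0: "ipoly (prime_cyclotomic p) (zeta p) = 0"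
    using assms by (intro ipoly_prime_cyclotomic_zeta prime_gt_1_nat)
  show "prime_cyclotomic p dvd f" if "ipoly f (zeta p) = 0"
    using irreducible_dvd_of_common_root[OF irreducible_prime_cyclotomic[OF assms] 0 that] .
  show "ipoly f (zeta p) = 0" if "prime_cyclotomic p dvd f"
    using that 0 by auto
qed

text \<open>Polynomials of unbounded degree serve as representatives because they are closed under
  products; the reduction to degree at most p - 2 is left to
  \<open>ideal_A_eq_kernel\<close>.\<close>

lemma carrier_cyclotomic_ring: "carrier (cyclotomic_ring p) = range (\<lambda>f. ipoly f (zeta p))"
proof (intro subset_antisym subsetI)
  fix x assume "x \<in> carrier (cyclotomic_ring p)"
  then have "x \<in> generate_ring ring_of_type_algebra {zeta p}"
    by (simp add: cyclotomic_ring_def)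
  then show "x \<in> range (\<lambda>f. ipoly f (zeta p))"
  proof (induction rule: generate_ring.induct)
    case one
    show ?case by (intro range_eqI[of _ _ 1]) (simp add: ring_of_type_algebra_def)
  next
    case (incl h)
    then show ?case by (intro range_eqI[of _ _ "[:0, 1:]"]) (simp add: map_poly_pCons)
  next
    case (a_inv h)
    then obtain f where "h = ipoly f (zeta p)" by blast
    then show ?case by (intro range_eqI[of _ _ "- f"]) simp
  next
    case (eng_add h k)
    then obtain f g where "h = ipoly f (zeta p)" "k = ipoly g (zeta p)" by blast
    then show ?case
      by (intro range_eqI[of _ _ "f + g"]) (simp add: ring_of_type_algebra_def)
  next
    case (eng_mult h k)
    then obtain f g where "h = ipoly f (zeta p)" "k = ipoly g (zeta p)" by blast
    then show ?case
      by (intro range_eqI[of _ _ "f * g"]) (simp add: ring_of_type_algebra_def)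
  qed
next
  interpret R: cring "cyclotomic_ring p" by (rule cring_cyclotomic_ring)
  have nat: "of_nat k \<in> carrier (cyclotomic_ring p)" for k
    using R.zero_closed R.one_closed R.a_closed by (induction k) auto
  have neg: "- x \<in> carrier (cyclotomic_ring p)" if "x \<in> carrier (cyclotomic_ring p)" for x
    using that generate_ring.a_inv[of x "ring_of_type_algebra :: complex ring" "{zeta p}"]
    by (simp add: cyclotomic_ring_def)
  have int: "of_int k \<in> carrier (cyclotomic_ring p)" for k
    using nat neg by (cases k rule: int_cases2) auto
  have "ipoly f (zeta p) \<in> carrier (cyclotomic_ring p)" for f
  proof (induction f rule: pCons_induct)
    case 0
    show ?case using R.zero_closed by simp
  next
    case (pCons c f)
    have "of_int c + zeta p * ipoly f (zeta p) \<in> carrier (cyclotomic_ring p)"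
      using R.a_closed[OF int[of c] R.m_closed[OF zeta_in_cyclotomic_ring pCons.IH]] by simp
    then show ?case by (simp add: map_poly_pCons)
  qed
  then show "x \<in> carrier (cyclotomic_ring p)" if "x \<in> range (\<lambda>f. ipoly f (zeta p))" for x
    using that by blast
qed

text \<open>The representing polynomial is an arbitrary choice; \<open>eval_mod_ipoly\<close> shows
  that the value does not depend on it. Outside the carrier of \<open>cyclotomic_ring p\<close> the
  value is meaningless.\<close>

definition eval_mod :: "nat \<Rightarrow> int \<Rightarrow> int \<Rightarrow> complex \<Rightarrow> int" where
  "eval_mod p n b x = poly (SOME f. ipoly f (zeta p) = x) b mod n"

text \<open>Two representatives of one element differ by a multiple of
  \<open>prime_cyclotomic p\<close>, whose value at \<open>b\<close> is the sum that
  \<open>n\<close> divides.\<close>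

lemma eval_mod_ipoly:
  assumes p: "Factorial_Ring.prime p" and b: "n dvd (\<Sum>i<p. b ^ i)"
  shows "eval_mod p n b (ipoly f (zeta p)) = poly f b mod n"
proof -
  define g where "g = (SOME g. ipoly g (zeta p) = ipoly f (zeta p))"
  have "ipoly g (zeta p) = ipoly f (zeta p)"
    unfolding g_def by (rule someI) (rule refl)
  then have "ipoly (g + - f) (zeta p) = 0" unfolding ipoly_add ipoly_uminus by simp
  then obtain k where "g + - f = prime_cyclotomic p * k"
    using prime_cyclotomic_dvd_iff[OF p] by blast
  then have "poly (g + - f) b = (\<Sum>i<p. b ^ i) * poly k b"
    using ipoly_prime_cyclotomic[of p b] by simp
  then have "n dvd poly g b - poly f b" using b by simp
  then show ?thesis by (simp add: eval_mod_def g_def[symmetric] mod_eq_dvd_iff)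
qed

text \<open>To write a kernel element with exponents up to p - 2, divide a representative by
  \<open>prime_cyclotomic p\<close>. The remainder has the same value at \<open>zeta p\<close> and,
  modulo \<open>n\<close>, at \<open>b\<close>.\<close>

lemma ideal_A_eq_kernel:
  assumes p: "Factorial_Ring.prime p" and b: "n dvd (\<Sum>i<p. b ^ i)"
  shows "ideal_A p n b = {x \<in> carrier (cyclotomic_ring p). eval_mod p n b x = 0}"
proof (intro subset_antisym subsetI)
  fix x assume "x \<in> ideal_A p n b"
  then obtain c where c: "x = (\<Sum>i = 0..p - 2. of_int (c i) * zeta p ^ i)"
      "n dvd (\<Sum>i = 0..p - 2. c i * b ^ i)"
    by (auto simp: ideal_A_def cong_0_iff)
  define f where "f = (\<Sum>i = 0..p - 2. monom (c i) i)"
  have "x = ipoly f (zeta p)" by (simp add: c f_def ipoly_sum ipoly_monom)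
  moreover have "n dvd poly f b" using c(2) by (simp add: f_def poly_sum poly_monom)
  ultimately show "x \<in> {x \<in> carrier (cyclotomic_ring p). eval_mod p n b x = 0}"
    using eval_mod_ipoly[OF p b] by (simp add: carrier_cyclotomic_ring)
next
  let ?C = "prime_cyclotomic p"
  have p1: "p > 1" using p by (rule prime_gt_1_nat)
  fix x assume "x \<in> {x \<in> carrier (cyclotomic_ring p). eval_mod p n b x = 0}"
  then obtain f where f: "x = ipoly f (zeta p)" "n dvd poly f b"
    using eval_mod_ipoly[OF p b] by (auto simp: carrier_cyclotomic_ring)
  have lc: "lead_coeff ?C = 1" and nz: "?C \<noteq> 0"
    using p1 by (auto simp: degree_prime_cyclotomic coeff_prime_cyclotomic poly_eq_iff)
  \<comment> \<open>The divisor is monic, so pseudo-division does not scale \<open>f\<close> and is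
    ordinary division with remainder.\<close>
  obtain q r where qr: "pseudo_divmod f ?C = (q, r)" by fastforce
  have eq: "f = ?C * q + r" using pseudo_divmod(1)[OF nz qr] by (simp add: lc)
  have "r = 0 \<or> degree r < p - 1"
    using pseudo_divmod(2)[OF nz qr] by (simp add: degree_prime_cyclotomic)
  then have deg: "degree r \<le> p - 2" using p1 by auto
  have "x = ipoly r (zeta p)"
    using f(1) ipoly_prime_cyclotomic_zeta[OF p1] by (simp add: eq)
  moreover have "poly f b = (\<Sum>i<p. b ^ i) * poly q b + poly r b"
    using ipoly_prime_cyclotomic[of p b] by (simp add: eq)
  then have "n dvd poly r b" using f(2) b by (metis dvd_add_right_iff dvd_mult2)
  ultimately show "x \<in> ideal_A p n b"
    using ipoly_altdef[OF deg, of "zeta p"] ipoly_altdef[OF deg, of b]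
    unfolding ideal_A_def cong_0_iff
    by (intro CollectI exI[of _ "coeff r"]) (simp add: atMost_atLeast0)
qed

lemma ring_hom_eval_mod:
  assumes p: "Factorial_Ring.prime p" and b: "n dvd (\<Sum>i<p. b ^ i)" and n: "n > 1"
  shows "ring_hom_ring (cyclotomic_ring p) (residue_ring n) (eval_mod p n b)"
proof -
  interpret R: cring "cyclotomic_ring p" by (rule cring_cyclotomic_ring)
  interpret S: residues n "residue_ring n" by unfold_locales (use n in simp_all)
  note ev = eval_mod_ipoly[OF p b]
  show ?thesis
  proof (rule ring_hom_ringI[OF R.ring_axioms S.ring_axioms])
    show "eval_mod p n b x \<in> carrier (residue_ring n)" if "x \<in> carrier (cyclotomic_ring p)" for x
      using that by (auto simp: carrier_cyclotomic_ring ev)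
  next
    fix x y assume "x \<in> carrier (cyclotomic_ring p)" "y \<in> carrier (cyclotomic_ring p)"
    then obtain f g where fg: "x = ipoly f (zeta p)" "y = ipoly g (zeta p)"
      by (auto simp: carrier_cyclotomic_ring)
    show "eval_mod p n b (x \<otimes>\<^bsub>cyclotomic_ring p\<^esub> y) =
        eval_mod p n b x \<otimes>\<^bsub>residue_ring n\<^esub> eval_mod p n b y"
      using ev[of "f * g"] by (simp add: fg ev S.mult_cong)
    show "eval_mod p n b (x \<oplus>\<^bsub>cyclotomic_ring p\<^esub> y) =
        eval_mod p n b x \<oplus>\<^bsub>residue_ring n\<^esub> eval_mod p n b y"
      using ev[of "f + g"] by (simp add: fg ev S.add_cong)
  next
    show "eval_mod p n b \<one>\<^bsub>cyclotomic_ring p\<^esub> = \<one>\<^bsub>residue_ring n\<^esub>"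
      using ev[of 1] n by (simp add: S.res_one_eq)
  qed
qed

section \<open>Cayley graphs under ring isomorphisms\<close>

lemma digraph_iso_cayley_graph:
  assumes R: "ring R" and S: "ring S" and h: "h \<in> ring_iso R S" and C: "C \<subseteq> carrier R"
  shows "digraph_iso (with_proj (cayley_graph R C)) (with_proj (cayley_graph S (h ` C)))"
proof -
  interpret R: ring R by fact
  interpret S: ring S by fact
  have bij: "bij_betw h (carrier R) (carrier S)" and hom: "h \<in> ring_hom R S"
    using h by (auto simp: ring_iso_def)
  interpret h: ring_hom_ring R S h by (rule ring_hom_ringI2[OF R S hom])
  have inj: "inj_on h (carrier R)" and im: "carrier S = h ` carrier R"
    using bij by (auto simp: bij_betw_def)
  have diff: "h x \<ominus>\<^bsub>S\<^esub> h y = h (x \<ominus>\<^bsub>R\<^esub> y)" if "x \<in> carrier R" "y \<in> carrier R" for x y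
    using that by (simp add: a_minus_def)
  have "h x \<ominus>\<^bsub>S\<^esub> h y \<in> h ` C \<longleftrightarrow> x \<ominus>\<^bsub>R\<^esub> y \<in> C" if "x \<in> carrier R" "y \<in> carrier R" for x y
    using that C inj by (auto simp: diff inj_on_image_mem_iff)
  then have arcs: "parcs (cayley_graph S (h ` C)) = map_prod h h ` parcs (cayley_graph R C)"
    by (auto simp: cayley_graph_def im)
  have inj_arcs: "inj_on (map_prod h h) (parcs (cayley_graph R C))"
    by (rule inj_on_subset[OF map_prod_inj_on[OF inj inj]]) (auto simp: cayley_graph_def)
  \<comment> \<open>Arcs are pairs of vertices with the projections as tail and head, so the vertex
    map determines the arc map.\<close>
  define f where "f = \<lparr> iso_verts = h, iso_arcs = map_prod h h, iso_head = snd, iso_tail = fst \<rparr>"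
  have "wf_digraph (with_proj (cayley_graph R C))"
    by unfold_locales (auto simp: cayley_graph_def)
  then have "pre_digraph.digraph_isomorphism (with_proj (cayley_graph R C)) f"
    using inj inj_arcs
    by (simp add: pre_digraph.digraph_isomorphism_def f_def) (simp add: cayley_graph_def)
  moreover have "with_proj (cayley_graph S (h ` C)) = app_iso f (with_proj (cayley_graph R C))"
    by (simp add: app_iso_def f_def with_proj_def arcs) (simp add: cayley_graph_def im)
  ultimately show ?thesis unfolding digraph_iso_def by blast
qed

section \<open>The subgroup of powers of a modulo n\<close>

text \<open>The inverse of \<open>a\<close> is its power with exponent k - 1, so the powers with
  natural exponents already form a group.\<close>

lemma residue_cyclic_subgroup_eq:
  assumes n: "n > 1" and k: "k > 0" and a: "[a ^ k = 1] (mod n)"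
  shows "residue_cyclic_subgroup n a = range (\<lambda>i::nat. a ^ i mod n)"
proof -
  interpret S: residues n "residue_ring n" by unfold_locales (use n in simp_all)
  let ?U = "units_of (residue_ring n)"
  interpret U: comm_group ?U by (rule S.units_comm_group)
  have unit: "a ^ i mod n \<in> carrier ?U" for i :: nat
  proof -
    have "coprime (a ^ k) n" using cong_imp_coprime[OF cong_sym[OF a]] by simp
    then show ?thesis using k n by (simp add: units_of_def)
  qed
  have mult: "(a ^ i mod n) \<otimes>\<^bsub>?U\<^esub> (a ^ j mod n) = a ^ (i + j) mod n" for i j
    by (simp add: units_of_def S.mult_cong power_add)
  have one: "\<one>\<^bsub>?U\<^esub> = 1" by (simp add: units_of_def S.res_one_eq)
  show ?thesis unfolding residue_cyclic_subgroup_def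
  proof (intro subset_antisym subsetI)
    fix x assume "x \<in> generate ?U {a mod n}"
    then show "x \<in> range (\<lambda>i. a ^ i mod n)"
    proof (induction rule: generate.induct)
      case one
      show ?case using n by (intro range_eqI[of _ _ 0]) (simp add: \<open>\<one>\<^bsub>?U\<^esub> = 1\<close>)
    next
      case (incl h)
      then show ?case by (intro range_eqI[of _ _ 1]) simp
    next
      case (inv h)
      \<comment> \<open>The factor is written as \<open>a ^ 1\<close> so that \<open>mult\<close>
        can be applied.\<close>
      have "(a ^ (k - 1) mod n) \<otimes>\<^bsub>?U\<^esub> (a ^ 1 mod n) = \<one>\<^bsub>?U\<^esub>"
        unfolding mult \<open>\<one>\<^bsub>?U\<^esub> = 1\<close> using a k n by (simp add: cong_def)
      then have "inv\<^bsub>?U\<^esub> (a mod n) = a ^ (k - 1) mod n"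
        using unit[of 1] unit[of "k - 1"] by (intro U.inv_equality) simp_all
      then show ?case using inv by auto
    next
      case (eng g h)
      then obtain i j where "g = a ^ i mod n" "h = a ^ j mod n" by blast
      then have "g \<otimes>\<^bsub>?U\<^esub> h = a ^ (i + j) mod n" by (simp only: mult)
      then show ?case by blast
    qed
  next
    fix x assume "x \<in> range (\<lambda>i. a ^ i mod n)"
    then obtain i where x: "x = a ^ i mod n" by blast
    show "x \<in> generate ?U {a mod n}" unfolding x
    proof (induction i)
      case 0
      show ?case using generate.one[of ?U "{a mod n}"] n by (simp add: one)
    next
      case (Suc i)
      have "(a ^ i mod n) \<otimes>\<^bsub>?U\<^esub> (a ^ 1 mod n) \<in> generate ?U {a mod n}"
        using generate.eng[OF Suc generate.incl[of "a mod n"]] by simp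
      then show ?case unfolding mult by simp
    qed
  qed
qed

text \<open>Divide the exponent by \<open>p\<close>: each full block of \<open>p\<close> factors
  contributes -1, and passing from \<open>a\<close> to \<open>-a\<close> changes at most the sign.
  Conversely, a minus sign is absorbed by adding \<open>p\<close> to the exponent.\<close>

lemma range_power_mod_eq:
  fixes a n :: int
  assumes p: "odd p" and a: "[a ^ p + 1 = 0] (mod n)"
  shows "range (\<lambda>i::nat. a ^ i mod n) =
    (\<lambda>i. (-a) ^ i mod n) ` {0..p - 1} \<union> (\<lambda>i. (- ((-a) ^ i)) mod n) ` {0..p - 1}" (is "_ = ?P \<union> ?N")
proof (intro subset_antisym subsetI)
  have ap: "[a ^ p = - 1] (mod n)"
    using a by (simp add: cong_iff_dvd_diff)
  have p0: "p > 0" using p by (rule odd_pos)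
  {
    fix x assume "x \<in> range (\<lambda>i::nat. a ^ i mod n)"
    then obtain i where x: "x = a ^ i mod n" by blast
    have "[(a ^ p) ^ (i div p) * a ^ (i mod p) = (- 1) ^ (i div p) * a ^ (i mod p)] (mod n)"
      using ap by (intro cong_mult cong_pow) auto
    then have "[a ^ i = (- 1) ^ (i div p) * a ^ (i mod p)] (mod n)"
      by (simp flip: power_mult power_add)
    moreover have "(- 1) ^ (i div p) * a ^ (i mod p) = (- a) ^ (i mod p) \<or>
        (- 1) ^ (i div p) * a ^ (i mod p) = - ((- a) ^ (i mod p))"
      by (cases "even (i div p)"; cases "even (i mod p)") auto
    moreover have "i mod p \<in> {0..p - 1}" using mod_less_divisor[OF p0, of i] by simp
    ultimately have "x = (- a) ^ (i mod p) mod n \<or> x = (- ((- a) ^ (i mod p))) mod n"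
      unfolding x cong_def by metis
    then show "x \<in> ?P \<union> ?N" using \<open>i mod p \<in> {0..p - 1}\<close> by blast
  }
  {
    fix x assume "x \<in> ?P \<union> ?N"
    then obtain i where "x = (-a) ^ i mod n \<or> x = (- ((-a) ^ i)) mod n" by blast
    then have "x = a ^ i mod n \<or> x = (- (a ^ i)) mod n"
      by (cases "even i") auto
    moreover have "(- (a ^ i)) mod n = a ^ (p + i) mod n"
      using cong_mult[OF ap cong_refl[of "a ^ i"]] by (simp add: cong_def power_add)
    ultimately show "x \<in> range (\<lambda>i::nat. a ^ i mod n)" by auto
  }
qed

section \<open>The quotient ring and the isomorphism of the two graphs\<close>

theorem theorem5p5:
  fixes p :: nat and n a :: int
  assumes "Factorial_Ring.prime p" and "odd p"
    and "n \<ge> 2 * int p + 1" and "[n = 1] (mod (2 * int p))"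
    and "a > 0" and "[a ^ p + 1 = 0] (mod n)"
    and "\<And>i. i \<in> {1..p - 1} \<Longrightarrow> gcd (a ^ i + 1) n = 1"
    and "\<And>i. i \<in> {1..p - 1} \<Longrightarrow> gcd (a ^ i - 1) n = 1"
  shows "digraph_iso
           (with_proj (cayley_graph (residue_ring n) (residue_cyclic_subgroup n a)))
           (with_proj (graph_G p (ideal_A p n (- a))))"
proof -
  let ?R = "cyclotomic_ring p" and ?S = "residue_ring n"
  define b where "b = - a"
  define A where "A = ideal_A p n b"
  let ?Q = "?R Quot A"
  have p1: "p > 1" using assms(1) by (rule prime_gt_1_nat)
  have n: "n > 1" using assms(3) p1 by simp
  have b_sum: "n dvd (\<Sum>i<p. b ^ i)"
  proof -
    \<comment> \<open>As \<open>p\<close> is odd, the right-hand side is minus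
      \<open>a ^ p + 1\<close>, a multiple of \<open>n\<close>. The factor b - 1 is minus a + 1,
      which the gcd hypothesis at exponent 1 makes coprime to \<open>n\<close>.\<close>
    have "(b - 1) * (\<Sum>i<p. b ^ i) = b ^ p - 1" by (simp add: power_diff_1_eq)
    also have "\<dots> = - (a ^ p + 1)" using assms(2) by (simp add: b_def)
    finally have "n dvd (b - 1) * (\<Sum>i<p. b ^ i)"
      using assms(6) by (simp only: cong_0_iff dvd_minus_iff)
    moreover have "coprime n (b - 1)"
    proof -
      have "gcd (a + 1) n = 1" using assms(7)[of 1] p1 by simp
      then have "coprime (a + 1) n" by (simp only: coprime_iff_gcd_eq_1)
      then have "coprime (- (a + 1)) n" by (simp only: coprime_minus_left_iff)
      then show ?thesis by (simp add: b_def coprime_commute)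
    qed
    ultimately show ?thesis by (simp add: coprime_dvd_mult_right_iff)
  qed
  interpret h: ring_hom_ring ?R ?S "eval_mod p n b"
    by (rule ring_hom_eval_mod[OF assms(1) b_sum n])
  interpret S: residues n ?S by unfold_locales (use n in simp_all)
  note ev = eval_mod_ipoly[OF assms(1) b_sum]
  have ker: "a_kernel ?R ?S (eval_mod p n b) = A"
    unfolding A_def ideal_A_eq_kernel[OF assms(1) b_sum] a_kernel_def' by (simp add: S.res_zero_eq)
  \<comment> \<open>The map of the first isomorphism theorem: evaluation is constant on a coset of
    its kernel, so the image is a singleton and \<open>the_elem\<close> extracts its value.\<close>
  define \<phi> where "\<phi> M = the_elem (eval_mod p n b ` M)" for M
  have surj: "eval_mod p n b ` carrier ?R = carrier ?S"
  proof (intro subset_antisym subsetI)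
    fix x assume "x \<in> carrier ?S"
    \<comment> \<open>Constant polynomials already reach every residue.\<close>
    then have "x = eval_mod p n b (ipoly [:x:] (zeta p))" unfolding ev by (simp add: S.res_carrier_eq)
    then show "x \<in> eval_mod p n b ` carrier ?R" unfolding carrier_cyclotomic_ring by blast
  qed auto
  have iso: "\<phi> \<in> ring_iso ?Q ?S"
    using h.FactRing_iso_set[OF surj] by (simp add: ker \<phi>_def[abs_def])
  have Q: "ring ?Q"
    using ideal.quotient_is_ring[OF h.kernel_is_ideal] by (simp add: ker)
  interpret \<phi>: ring_hom_ring ?Q ?S \<phi>
    using iso by (intro ring_hom_ringI2 Q h.S.ring_axioms) (auto simp: ring_iso_def)
  have zeta: "zeta p ^ i = ipoly (monom 1 i) (zeta p)" for i by (simp add: ipoly_monom)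
  have zeta_R: "zeta p ^ i \<in> carrier ?R" for i unfolding carrier_cyclotomic_ring zeta by blast
  have coset: "A +>\<^bsub>?R\<^esub> zeta p ^ i \<in> carrier ?Q" for i
    using zeta_R by (auto simp: FactRing_def A_RCOSETS_def')
  have phi_coset: "\<phi> (A +>\<^bsub>?R\<^esub> zeta p ^ i) = b ^ i mod n" for i
    using h.the_elem_simp[OF zeta_R] ev[of "monom 1 i"] by (simp add: ker \<phi>_def poly_monom zeta)
  have phi_minus: "\<phi> (\<ominus>\<^bsub>?Q\<^esub> (A +>\<^bsub>?R\<^esub> zeta p ^ i)) = (- (b ^ i)) mod n" for i
    using coset by (simp add: phi_coset S.neg_cong)
  define C where "C = (\<lambda>i. A +>\<^bsub>?R\<^esub> zeta p ^ i) ` {0..p - 1} \<union>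
    (\<lambda>i. \<ominus>\<^bsub>?Q\<^esub> (A +>\<^bsub>?R\<^esub> zeta p ^ i)) ` {0..p - 1}"
  have C: "C \<subseteq> carrier ?Q" using coset by (auto simp: C_def)
  \<comment> \<open>Squaring a^p = -1 yields the exponent 2p for
    \<open>residue_cyclic_subgroup_eq\<close>.\<close>
  have "[(a ^ p)\<^sup>2 = (- 1)\<^sup>2] (mod n)"
    using assms(6) by (intro cong_pow) (simp add: cong_iff_dvd_diff)
  then have "[a ^ (2 * p) = 1] (mod n)" by (simp add: mult.commute flip: power_mult)
  then have "residue_cyclic_subgroup n a = range (\<lambda>i::nat. a ^ i mod n)"
    using n p1 by (intro residue_cyclic_subgroup_eq[of _ "2 * p"]) auto
  also have "\<dots> = \<phi> ` C"
    unfolding range_power_mod_eq[OF assms(2,6)] C_def image_Un image_image phi_coset phi_minus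
    by (simp add: b_def)
  finally have C_image: "residue_cyclic_subgroup n a = \<phi> ` C" .
  have "digraph_iso (with_proj (cayley_graph ?Q C)) (with_proj (cayley_graph ?S (\<phi> ` C)))"
    by (rule digraph_iso_cayley_graph[OF Q h.S.ring_axioms iso C])
  \<comment> \<open>\<open>\<phi>\<close> starts at the quotient, whereas the claim starts at the
    circulant. Reversing the isomorphism with \<open>digraph_iso_swap\<close> requires a well-formed
    graph.\<close>
  moreover have "wf_digraph (with_proj (cayley_graph ?Q C))"
    by unfold_locales (auto simp: cayley_graph_def)
  ultimately have "digraph_iso (with_proj (cayley_graph ?S (\<phi> ` C))) (with_proj (cayley_graph ?Q C))"
    by (rule digraph_iso_swap[rotated])
  moreover have "graph_G p (ideal_A p n (- a)) = cayley_graph ?Q C"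
    unfolding graph_G_def Let_def C_def A_def b_def ..
  ultimately show ?thesis unfolding C_image by simp
qed

end
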